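(* There does not exist a domain $D\subset\mathbb{C}^n$ such that its Bergman space $A^2(D)$ has an orthonormal basis of the form $\left\{\frac{z^\alpha}{\sqrt{\alpha!}}\,\phi\right\}_{\alpha\in(\mathbb{N}_0)^n}$, where $\phi\in A^2(D)$, $\phi\ne0$ and $\|\phi\|=1$.
   Context: Here $n\ge1$ and a domain is a nonempty connected open subset. $A^2(D)$ is the Hilbert space of holomorphic functions on $D$ that are square integrable with respect to Lebesgue measure, with the $L^2(D)$ inner product and norm $\|\cdot\|$. $\mathbb{N}_0$ is the set of non-negative integers; for $\alpha=(\alpha_1,\dots,\alpha_n)\in(\mathbb{N}_0)^n$, $z^\alpha=z_1^{\alpha_1}\cdots z_n^{\alpha_n}$ and $\alpha!=\alpha_1!\cdots\alpha_n!$. *)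

theory Defs
  imports "HOL-Analysis.Analysis"
begin

definition cdomain :: "(complex ^ 'n) set \<Rightarrow> bool" where
  "cdomain D \<longleftrightarrow> D \<noteq> {} \<and> open D \<and> connected D"

text \<open>
  Holomorphy in several variables is complex (Frechet) differentiability at every point:
  the real derivative exists and is linear over the complex numbers.
\<close>
definition mv_holomorphic_on :: "(complex ^ 'n \<Rightarrow> complex) \<Rightarrow> (complex ^ 'n) set \<Rightarrow> bool"
    (infixl \<open>mv'_holomorphic'_on\<close> 50) where
  "f mv_holomorphic_on D \<longleftrightarrow>
     (\<forall>z\<in>D. \<exists>L. Vector_Spaces.linear (*s) (*) L \<and> (f has_derivative L) (at z within D))"

text \<open>
  Elements of the Bergman space are represented by total functions of which only the values
  on \<open>D\<close> matter; two of them are the same element iff they agree on \<open>D\<close>.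
\<close>
definition bergman_space :: "(complex ^ 'n) set \<Rightarrow> (complex ^ 'n \<Rightarrow> complex) set" where
  "bergman_space D =
     {f. f mv_holomorphic_on D \<and> set_integrable lebesgue D (\<lambda>z. (cmod (f z))\<^sup>2)}"

definition L2_inner ::
    "(complex ^ 'n) set \<Rightarrow> (complex ^ 'n \<Rightarrow> complex) \<Rightarrow> (complex ^ 'n \<Rightarrow> complex) \<Rightarrow> complex" where
  "L2_inner D f g = (LINT z:D|lebesgue. f z * cnj (g z))"

definition L2_norm :: "(complex ^ 'n) set \<Rightarrow> (complex ^ 'n \<Rightarrow> complex) \<Rightarrow> real" where
  "L2_norm D f = sqrt (LINT z:D|lebesgue. (cmod (f z))\<^sup>2)"

text \<open>An orthonormal family in the Bergman space whose complex linear span is dense.\<close>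
definition bergman_orthonormal_basis ::
    "(complex ^ 'n) set \<Rightarrow> ('i \<Rightarrow> complex ^ 'n \<Rightarrow> complex) \<Rightarrow> bool" where
  "bergman_orthonormal_basis D e \<longleftrightarrow>
     (\<forall>i. e i \<in> bergman_space D) \<and>
     (\<forall>i j. L2_inner D (e i) (e j) = (if i = j then 1 else 0)) \<and>
     (\<forall>f\<in>bergman_space D. \<forall>\<epsilon>>0. \<exists>I c. finite I \<and>
        L2_norm D (\<lambda>z. f z - (\<Sum>i\<in>I. c i * e i z)) < \<epsilon>)"

definition mv_power :: "complex ^ 'n \<Rightarrow> nat ^ 'n \<Rightarrow> complex" where
  "mv_power z \<alpha> = (\<Prod>i\<in>UNIV. (z $ i) ^ (\<alpha> $ i))"

definition mv_fact :: "nat ^ 'n \<Rightarrow> nat" where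
  "mv_fact \<alpha> = (\<Prod>i\<in>UNIV. fact (\<alpha> $ i))"

end

theory Submission
  imports Defs "HOL-Probability.Characteristic_Functions" "HOL-Complex_Analysis.Conformal_Mappings"
begin

text \<open>
  Orthonormality of the functions \<open>z\<^sup>\<alpha> \<phi> / sqrt \<alpha>!\<close> says that the function \<open>f = |\<phi>|\<^sup>2\<close>, extended by
  \<open>0\<close> outside of \<open>D\<close>, has the moments \<open>\<integral> f z\<^sup>\<alpha> cnj z\<^sup>\<beta> = (if \<alpha> = \<beta> then \<alpha>! else 0)\<close>. These are the
  moments of the Gaussian density \<open>exp (- |z|\<^sup>2) / \<pi> ^ n\<close>, and they determine it. Indeed,
  summing the moments \<open>\<integral> f |z\<^sup>\<alpha>|\<^sup>2 = \<alpha>!\<close> shows that \<open>f\<close> is integrable against \<open>exp (|z|\<^sup>2 / 2)\<close>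
  (\<open>exp_square_integrable\<close>), so that the exponential series may be integrated term by term and
  the Fourier transform of \<open>f\<close> is that of the Gaussian (\<open>fourier_transform\<close>).

  An integrable function whose Fourier transform vanishes is zero at each of its points of
  continuity (\<open>fourier_zero_imp_zero_at_continuity_point\<close>). As \<open>f\<close> is continuous on the open
  set \<open>D\<close>, this gives \<open>|\<phi>|\<^sup>2 = exp (- |z|\<^sup>2) / \<pi> ^ n\<close> on all of \<open>D\<close>. No holomorphic function has
  such a modulus on a nonempty open set: \<open>ln |\<phi>|\<close> would be pluriharmonic, whereas \<open>- |z|\<^sup>2 / 2\<close>
  is not. The proof of \<open>holomorphic_modulus_not_gaussian\<close> phrases this with the maximum modulus
  principle.
\<close>

section \<open>Gaussian integrals and Fourier uniqueness\<close>

text \<open>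
  The one-dimensional case is the characteristic function of the standard normal
  distribution, rescaled by the factor \<open>sqrt a\<close>.
\<close>
lemma gaussian_fourier_real:
  fixes a t :: real
  assumes a: "a > 0"
  shows "integrable lborel (\<lambda>x. iexp (t * x) * complex_of_real (exp (- (a * x\<^sup>2 / 2))))" (is ?int)
    and "(LINT x|lborel. iexp (t * x) * complex_of_real (exp (- (a * x\<^sup>2 / 2)))) =
           complex_of_real (sqrt (2 * pi / a) * exp (- (t\<^sup>2 / (2 * a))))" (is ?eq)
proof -
  let ?g = "\<lambda>u x. std_normal_density x *\<^sub>R iexp (u * x)"
  have int: "integrable lborel (?g u)" for u
    by (rule Bochner_Integration.integrable_bound[of _ std_normal_density]) auto
  have val: "(LINT x|lborel. ?g u x) = complex_of_real (exp (- (u\<^sup>2 / 2)))" for u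
    using char_std_normal_distribution
    by (subst (asm) fun_eq_iff) (auto simp: char_def integral_density)
  define s where "s = sqrt a"
  have s: "s > 0" "s\<^sup>2 = a" using a by (auto simp: s_def)
  define k where "k = sqrt (2 * pi)"
  have k: "k > 0" "sqrt (pi * 2) = k" by (auto simp: k_def mult.commute)
  have eq: "iexp (t * x) * complex_of_real (exp (- (a * x\<^sup>2 / 2))) = k *\<^sub>R ?g (t / s) (0 + s * x)" for x
    using s k by (auto simp: std_normal_density_def k_def[symmetric] scaleR_conv_of_real power_mult_distrib field_simps)
  show ?int
    unfolding eq
    using s by (intro integrable_scaleR_right lborel_integrable_real_affine int) auto
  have "(LINT x|lborel. ?g (t / s) x) = \<bar>s\<bar> *\<^sub>R (LINT x|lborel. ?g (t / s) (0 + s * x))"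
    using s by (intro lborel_integral_real_affine) auto
  then have "(LINT x|lborel. ?g (t / s) (0 + s * x)) = complex_of_real (exp (- ((t/s)\<^sup>2 / 2)) / s)"
    using s unfolding val by (auto simp: field_simps scaleR_conv_of_real)
  then show ?eq
    unfolding eq using s 
    by (simp add: scaleR_conv_of_real k_def s_def real_sqrt_divide power_divide)
qed

text \<open>
  Both the Gaussian and the character \<open>x \<mapsto> exp (\<i> (u \<bullet> x))\<close> are products of functions of one
  coordinate, and Lebesgue measure is a product measure, so the integral splits.
\<close>
lemma gaussian_fourier:
  fixes u :: "'a::euclidean_space"
  assumes a: "a > 0"
  shows "integrable lborel (\<lambda>x. iexp (u \<bullet> x) * complex_of_real (exp (- (a * (norm x)\<^sup>2 / 2))))" (is ?int)
    and "(LINT x|lborel. iexp (u \<bullet> x) * complex_of_real (exp (- (a * (norm x)\<^sup>2 / 2)))) =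
           complex_of_real (sqrt (2 * pi / a) ^ DIM('a) * exp (- ((norm u)\<^sup>2 / (2 * a))))" (is ?eq)
proof -
  let ?h = "\<lambda>b x. iexp ((u \<bullet> b) * x) * complex_of_real (exp (- (a * x\<^sup>2 / 2)))"
  let ?f = "\<lambda>x. iexp (u \<bullet> x) * complex_of_real (exp (- (a * (norm x)\<^sup>2 / 2)))"
  let ?T = "\<lambda>y::'a\<Rightarrow>real. \<Sum>b\<in>Basis. y b *\<^sub>R b"
  interpret product_sigma_finite "\<lambda>_::'a. lborel :: real measure" ..
  have norm_Basis: "(norm x)\<^sup>2 = (\<Sum>b\<in>Basis. (x \<bullet> b)\<^sup>2)" for x :: 'a
    by (subst power2_norm_eq_inner, subst euclidean_inner) (simp add: power2_eq_square)
  have T: "?T y \<bullet> b = y b" if "b \<in> Basis" for y b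
    using that by simp
  have eq: "?f (?T y) = (\<Prod>b\<in>Basis. ?h b (y b))" for y
  proof -
    have "u \<bullet> ?T y = (\<Sum>b\<in>Basis. (u \<bullet> b) * y b)"
      by (simp add: inner_sum_right mult.commute)
    moreover have "(norm (?T y))\<^sup>2 = (\<Sum>b\<in>Basis. (y b)\<^sup>2)"
      unfolding norm_Basis by (rule sum.cong) (auto simp: T)
    ultimately show ?thesis
      by (simp add: prod.distrib sum_distrib_left sum_negf[symmetric] sum_divide_distrib exp_sum 
             del: inner_sum_left_Basis of_real_exp flip: exp_of_real)
  qed
  have meas: "?T \<in> measurable (Pi\<^sub>M Basis (\<lambda>_. lborel)) borel" by measurable
  have "integrable (Pi\<^sub>M Basis (\<lambda>_. lborel)) (\<lambda>y. ?f (?T y))"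
    unfolding eq by (intro product_integrable_prod gaussian_fourier_real a finite_Basis)
  then show ?int
    by (subst lborel_eq, subst integrable_distr_eq) (use meas in auto)
  have "integral\<^sup>L lborel ?f = integral\<^sup>L (Pi\<^sub>M Basis (\<lambda>_. lborel)) (\<lambda>y. ?f (?T y))"
    by (subst lborel_eq, subst integral_distr) (use meas in auto)
  also have "\<dots> = (\<Prod>b\<in>Basis. integral\<^sup>L lborel (?h b))"
    unfolding eq by (intro product_integral_prod gaussian_fourier_real a finite_Basis)
  also have "\<dots> = (\<Prod>b\<in>Basis. complex_of_real (sqrt (2 * pi / a) * exp (- ((u \<bullet> b)\<^sup>2 / (2 * a)))))"
    by (simp only: gaussian_fourier_real[OF a])
  also have "\<dots> = complex_of_real (\<Prod>b\<in>Basis. sqrt (2 * pi / a) * exp (- ((u \<bullet> b)\<^sup>2 / (2 * a))))"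
    by simp
  also have "(\<Prod>b\<in>(Basis::'a set). sqrt (2 * pi / a) * exp (- ((u \<bullet> b)\<^sup>2 / (2 * a)))) =
     sqrt (2 * pi / a) ^ DIM('a) * exp (- ((norm u)\<^sup>2 / (2 * a)))"
    unfolding norm_Basis prod.distrib by (simp add: exp_sum sum_divide_distrib sum_negf[symmetric])
  finally show ?eq .
qed

text \<open>
  A Gaussian is a superposition of characters with an integrable (again Gaussian) weight.
  Fubini's theorem therefore writes its integral against \<open>h\<close> as a superposition of values of the
  Fourier transform of \<open>h\<close>.
\<close>
lemma gaussian_mean_eq_0:
  fixes h :: "'a::euclidean_space \<Rightarrow> real"
  assumes h: "integrable lborel h"
    and ft: "\<And>\<xi>. (LINT y|lborel. iexp (\<xi> \<bullet> y) * complex_of_real (h y)) = 0"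
    and s: "s > 0"
  shows "(LINT y|lborel. h y * exp (- (s * (norm (y - x))\<^sup>2))) = 0"
proof -
  \<comment> \<open>The width whose Fourier transform decays like \<open>exp (- s |y|\<^sup>2)\<close>.\<close>
  define a where "a = 1 / (2 * s)"
  have a: "a > 0" using s by (simp add: a_def)
  define g where "g = (\<lambda>\<xi>::'a. exp (- (a * (norm \<xi>)\<^sup>2 / 2)))"
  define C where "C = sqrt (2 * pi / a) ^ DIM('a)"
  have C: "C > 0" using a by (simp add: C_def)
  have gint: "integrable lborel g"
  proof -
    have "integrable lborel (\<lambda>\<xi>. complex_of_real (g \<xi>))"
      using gaussian_fourier(1)[OF a, of "0::'a"] by (simp add: g_def)
    then show ?thesis using integrable_Re by fastforce
  qed
  let ?K = "\<lambda>(y, \<xi>). iexp ((y - x) \<bullet> \<xi>) * complex_of_real (g \<xi>) * complex_of_real (h y)"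
  have [measurable]: "h \<in> borel_measurable borel" "g \<in> borel_measurable borel"
    using h gint by (auto dest: borel_measurable_integrable)
  have "integrable (lborel \<Otimes>\<^sub>M lborel) (\<lambda>(y, \<xi>). h y * g \<xi>)"
    by (rule lborel_pair.Fubini_integrable) (use h gint in \<open>auto simp: abs_mult\<close>)
  then have K: "integrable (lborel \<Otimes>\<^sub>M lborel) ?K"
    by (rule Bochner_Integration.integrable_bound) (auto simp: norm_mult split_beta abs_mult)
  have gauss: "(LINT \<xi>|lborel. ?K (y, \<xi>)) = complex_of_real (C * (h y * exp (- (s * (norm (y - x))\<^sup>2))))" for y
    using gaussian_fourier(2)[OF a, of "y - x"]
    by (simp add: g_def C_def a_def)
  have zero: "(LINT y|lborel. ?K (y, \<xi>)) = 0" for \<xi>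
  proof -
    have "?K (y, \<xi>) = (iexp (- (x \<bullet> \<xi>)) * complex_of_real (g \<xi>)) * (iexp (\<xi> \<bullet> y) * complex_of_real (h y))" for y
      by (simp add: inner_diff_left inner_commute exp_add[symmetric] algebra_simps)
    then show ?thesis unfolding \<open>\<And>y. ?K (y, \<xi>) = _\<close> using ft by simp
  qed
  have "complex_of_real (C * (LINT y|lborel. h y * exp (- (s * (norm (y - x))\<^sup>2)))) = 
     (LINT y|lborel. (LINT \<xi>|lborel. ?K (y, \<xi>)))"
    unfolding gauss integral_complex_of_real by simp
  also have "\<dots> = (LINT \<xi>|lborel. (LINT y|lborel. ?K (y, \<xi>)))"
    using lborel_pair.Fubini_integral[of "\<lambda>y \<xi>. ?K (y, \<xi>)"] K by (simp add: split_beta)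
  also have "\<dots> = 0" unfolding zero by simp
  finally show ?thesis using C by simp
qed

text \<open>
  If \<open>h x > 0\<close>, then \<open>h \<ge> c > 0\<close> on a ball of radius \<open>\<delta>\<close> around \<open>x\<close>. For large \<open>s\<close> the part of the
  Gaussian mean over the ball of radius \<open>\<delta> / 2\<close>, at least a multiple of \<open>exp (- s \<delta>\<^sup>2 / 4)\<close>, beats
  the part outside the ball of radius \<open>\<delta>\<close>, at most a multiple of \<open>exp (- s \<delta>\<^sup>2)\<close>.
\<close>
lemma gaussian_means_le_0_at_continuity_point:
  fixes h :: "'a::euclidean_space \<Rightarrow> real"
  assumes h: "integrable lborel h"
    and mean: "\<And>s. s > 0 \<Longrightarrow> (LINT y|lborel. h y * exp (- (s * (norm (y - x))\<^sup>2))) = 0"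
    and cont: "isCont h x"
  shows "h x \<le> 0"
proof (rule ccontr)
  assume "\<not> h x \<le> 0"
  then have pos: "h x > 0" by simp
  define c where "c = h x / 2"
  have c: "c > 0" using pos by (simp add: c_def)
  obtain \<delta> where \<delta>: "\<delta> > 0" "\<And>y. dist y x < \<delta> \<Longrightarrow> dist (h y) (h x) < c"
    using cont c unfolding continuous_at_eps_delta by blast
  have near: "h y \<ge> c" if "norm (y - x) < \<delta>" for y
    using \<delta>(2)[of y] that by (auto simp: dist_norm c_def abs_if split: if_splits)
  define B where "B = ball x (\<delta> / 2)"
  define V where "V = measure lborel B"
  have V: "V > 0" using \<delta> unfolding V_def B_def by (simp add: content_ball_pos)
  have [measurable]: "h \<in> borel_measurable borel"
    using h by (auto dest: borel_measurable_integrable)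
  define N where "N = (LINT y|lborel. \<bar>h y\<bar>)"
  have main: "c * V * exp (3 * s * \<delta>\<^sup>2 / 4) \<le> N" if s: "s > 0" for s
  proof -
    let ?e = "\<lambda>y. exp (- (s * (norm (y - x))\<^sup>2))"
    have pt: "c * exp (- (s * \<delta>\<^sup>2 / 4)) * indicator B y - exp (- (s * \<delta>\<^sup>2)) * \<bar>h y\<bar> \<le> h y * ?e y" for y
    proof -
      consider "norm (y - x) < \<delta> / 2" | "\<delta> / 2 \<le> norm (y - x)" "norm (y - x) < \<delta>" | "\<delta> \<le> norm (y - x)"
        by linarith
      then show ?thesis
      proof cases
        case 1
        then have "(norm (y - x))\<^sup>2 \<le> (\<delta> / 2)\<^sup>2" by (intro power_mono) auto
        then have "exp (- (s * \<delta>\<^sup>2 / 4)) \<le> ?e y" using s by (simp add: power_divide)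
        then have "c * exp (- (s * \<delta>\<^sup>2 / 4)) \<le> h y * ?e y"
          using near[of y] 1 \<delta> c by (intro mult_mono) auto
        moreover have "c * exp (- (s * \<delta>\<^sup>2 / 4)) * indicator B y \<le> c * exp (- (s * \<delta>\<^sup>2 / 4))"
          using c by (auto simp: indicator_def)
        moreover have "0 \<le> exp (- (s * \<delta>\<^sup>2)) * \<bar>h y\<bar>" by simp
        ultimately show ?thesis by linarith
      next
        case 2
        then have "y \<notin> B" by (simp add: B_def dist_norm norm_minus_commute)
        moreover have "0 \<le> h y * ?e y" using near[of y] 2 c by simp
        ultimately show ?thesis by (simp add: order_trans[of _ 0])
      next
        case 3
        then have "y \<notin> B" using \<delta> by (simp add: B_def dist_norm norm_minus_commute)
        moreover have "\<delta>\<^sup>2 \<le> (norm (y - x))\<^sup>2" using 3 \<delta> by (intro power_mono) auto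
        then have "?e y \<le> exp (- (s * \<delta>\<^sup>2))" using s by simp
        then have "\<bar>h y\<bar> * ?e y \<le> \<bar>h y\<bar> * exp (- (s * \<delta>\<^sup>2))" by (intro mult_left_mono) auto
        then have "\<bar>h y * ?e y\<bar> \<le> exp (- (s * \<delta>\<^sup>2)) * \<bar>h y\<bar>" by (simp add: abs_mult mult.commute)
        ultimately show ?thesis by simp
      qed
    qed
    have i1: "integrable lborel (\<lambda>y. c * exp (- (s * \<delta>\<^sup>2 / 4)) * indicator B y :: real)"
      unfolding B_def by (intro integrable_mult_right integrable_real_indicator)
        (auto simp: emeasure_bounded_finite[unfolded infinity_ennreal_def])
    have i2: "integrable lborel (\<lambda>y. exp (- (s * \<delta>\<^sup>2)) * \<bar>h y\<bar>)"
      using h by auto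
    have i3: "integrable lborel (\<lambda>y. h y * ?e y)"
      using h by (rule Bochner_Integration.integrable_bound)
        (use s in \<open>auto simp: abs_mult intro!: mult_left_le\<close>)
    have "(LINT y|lborel. c * exp (- (s * \<delta>\<^sup>2 / 4)) * indicator B y - exp (- (s * \<delta>\<^sup>2)) * \<bar>h y\<bar>)
        \<le> (LINT y|lborel. h y * ?e y)"
      by (intro integral_mono i3 Bochner_Integration.integrable_diff i1 i2 pt)
    also have "\<dots> = 0" by (rule mean[OF s])
    finally have "c * exp (- (s * \<delta>\<^sup>2 / 4)) * V \<le> exp (- (s * \<delta>\<^sup>2)) * N"
      using i1 i2 by (simp add: V_def N_def)
    then have "exp (s * \<delta>\<^sup>2) * (c * exp (- (s * \<delta>\<^sup>2 / 4)) * V) \<le> exp (s * \<delta>\<^sup>2) * (exp (- (s * \<delta>\<^sup>2)) * N)"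
      by (intro mult_left_mono) auto
    also have "exp (s * \<delta>\<^sup>2) * (c * exp (- (s * \<delta>\<^sup>2 / 4)) * V) = c * V * exp (s * \<delta>\<^sup>2 + - (s * \<delta>\<^sup>2 / 4))"
      unfolding exp_add by (simp add: mult_ac)
    also have "s * \<delta>\<^sup>2 + - (s * \<delta>\<^sup>2 / 4) = 3 * s * \<delta>\<^sup>2 / 4" by (simp add: field_simps)
    also have "exp (s * \<delta>\<^sup>2) * (exp (- (s * \<delta>\<^sup>2)) * N) = N" by (simp add: exp_minus)
    finally show ?thesis .
  qed
  \<comment> \<open>A value of \<open>s\<close> for which already \<open>exp q \<ge> 1 + q\<close> contradicts the bound \<open>N\<close>.\<close>
  define q where "q = (N + 1) / (c * V)"
  define s where "s = 4 * q / (3 * \<delta>\<^sup>2)"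
  have N: "N \<ge> 0" unfolding N_def by simp
  have "s > 0" unfolding s_def q_def using \<delta> c V N by auto
  moreover have "3 * s * \<delta>\<^sup>2 / 4 = q"
    using \<delta>(1) by (simp add: s_def)
  ultimately have "c * V * exp q \<le> N"
    using main[of s] by simp
  moreover have "c * V * (1 + q) \<le> c * V * exp q"
    using c V by (intro mult_left_mono exp_ge_add_one_self) auto
  moreover have "c * V * (1 + q) = c * V + N + 1"
    using c V by (simp add: q_def field_simps)
  moreover have "c * V > 0" using c V by simp
  ultimately show False by linarith
qed

text \<open>
  Fourier uniqueness in pointwise form. It is applied to the difference of two densities, one of
  which may jump at the boundary of a domain.
\<close>
lemma fourier_zero_imp_zero_at_continuity_point:
  fixes h :: "'a::euclidean_space \<Rightarrow> real"
  assumes h: "integrable lborel h"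
    and ft: "\<And>\<xi>. (LINT y|lborel. iexp (\<xi> \<bullet> y) * complex_of_real (h y)) = 0"
    and cont: "isCont h x"
  shows "h x = 0"
proof -
  have mean: "(LINT y|lborel. h y * exp (- (s * (norm (y - x))\<^sup>2))) = 0" if "s > 0" for s
    using gaussian_mean_eq_0[OF h ft that] .
  have "h x \<le> 0"
    by (rule gaussian_means_le_0_at_continuity_point[OF h mean cont])
  moreover have "- h x \<le> 0"
    by (rule gaussian_means_le_0_at_continuity_point[where h = "\<lambda>y. - h y" and x = x])
      (use h mean cont in auto)
  ultimately show ?thesis by simp
qed

section \<open>Multi-indices and partial products of the exponential series\<close>

lemma prod_sum_multi_index:
  fixes g :: "'n::finite \<Rightarrow> nat \<Rightarrow> 'b::comm_semiring_1"
  shows "(\<Prod>i\<in>UNIV. \<Sum>k<N. g i k) = (\<Sum>\<alpha>\<in>{\<alpha>::nat^'n. \<forall>i. \<alpha> $ i < N}. \<Prod>i\<in>UNIV. g i (\<alpha> $ i))"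
proof -
  have "(\<Prod>i\<in>UNIV. \<Sum>k<N. g i k) = (\<Sum>h\<in>PiE UNIV (\<lambda>_. {..<N}). \<Prod>i\<in>UNIV. g i (h i))"
    by (rule prod_sum_PiE) auto
  also have "\<dots> = (\<Sum>\<alpha>\<in>{\<alpha>::nat^'n. \<forall>i. \<alpha> $ i < N}. \<Prod>i\<in>UNIV. g i (\<alpha> $ i))"
    by (rule sum.reindex_bij_witness[of _ vec_nth vec_lambda]) (auto simp: PiE_UNIV_domain)
  finally show ?thesis .
qed

lemma finite_multi_index_box: "finite {\<alpha>::nat^'n::finite. \<forall>i. \<alpha> $ i < N}"
proof (rule finite_subset)
  show "{\<alpha>::nat^'n. \<forall>i. \<alpha> $ i < N} \<subseteq> vec_lambda ` (PiE UNIV (\<lambda>_. {..<N}))"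
    by (auto intro!: image_eqI[of _ _ "vec_nth _"] simp: PiE_UNIV_domain)
qed (intro finite_imageI finite_PiE; simp)

lemma mv_fact_neq_0 [simp]: "mv_fact \<alpha> \<noteq> 0"
  by (simp add: mv_fact_def)

lemma partial_exp_tendsto:
  fixes x :: "'a::{real_normed_field,banach}"
  shows "(\<lambda>N. \<Sum>k<N. x ^ k / fact k) \<longlonglongrightarrow> exp x"
  using exp_converges[of x] unfolding sums_def
  by (simp add: scaleR_conv_of_real divide_inverse mult.commute)

lemma norm_partial_exp_le:
  fixes x :: complex
  shows "norm (\<Sum>k<N. x ^ k / fact k) \<le> exp (norm x)"
proof -
  have "norm (\<Sum>k<N. x ^ k / fact k) \<le> (\<Sum>k<N. norm x ^ k / fact k)"
    by (rule sum_norm_le) (simp add: norm_divide norm_power)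
  also have "\<dots> \<le> exp (norm x)"
  proof (rule LIMSEQ_le_const[OF partial_exp_tendsto], intro exI[of _ N] allI impI)
    fix M assume "N \<le> M"
    then show "(\<Sum>k<N. norm x ^ k / fact k) \<le> (\<Sum>k<M. norm x ^ k / fact k)"
      by (intro sum_mono2) auto
  qed
  finally show ?thesis .
qed

lemma norm_vec_complex_sq: "(norm (z :: complex ^ 'n))\<^sup>2 = (\<Sum>i\<in>UNIV. (cmod (z $ i))\<^sup>2)"
  by (simp only: power2_norm_eq_inner inner_vec_def)

lemma borel_measurable_cnj [measurable (raw)]:
  "f \<in> borel_measurable M \<Longrightarrow> (\<lambda>x. cnj (f x)) \<in> borel_measurable M"
  by (rule measurable_compose[OF _ borel_measurable_continuous_onI]) (auto intro: continuous_intros)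

lemma borel_measurable_mv_power [measurable]: "(\<lambda>z. mv_power z \<alpha>) \<in> borel_measurable borel"
  unfolding mv_power_def by (intro borel_measurable_continuous_onI continuous_intros)

section \<open>Densities with Gaussian moments\<close>

text \<open>
  The moments are those of the density \<open>exp (- |z|\<^sup>2) / \<pi> ^ n\<close>; the point of the locale is that \<open>f\<close> has
  to be this density wherever it is continuous.
\<close>
locale gaussian_moments =
  fixes f :: "complex ^ 'n \<Rightarrow> real"
  assumes nonneg: "0 \<le> f z"
    and measurable_f [measurable]: "f \<in> borel_measurable borel"
    and moment_integrable: "integrable lborel (\<lambda>z. f z *\<^sub>R (mv_power z \<alpha> * cnj (mv_power z \<beta>)))"
    and moment: "(LINT z|lborel. f z *\<^sub>R (mv_power z \<alpha> * cnj (mv_power z \<beta>))) =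
                   (if \<alpha> = \<beta> then of_nat (mv_fact \<alpha>) else 0)"
begin

lemma abs_moment:
  shows "integrable lborel (\<lambda>z. f z * (cmod (mv_power z \<alpha>))\<^sup>2)"
    and "(LINT z|lborel. f z * (cmod (mv_power z \<alpha>))\<^sup>2) = real (mv_fact \<alpha>)"
proof -
  have eq: "f z *\<^sub>R (mv_power z \<alpha> * cnj (mv_power z \<alpha>)) = complex_of_real (f z * (cmod (mv_power z \<alpha>))\<^sup>2)" for z
    by (simp only: scaleR_conv_of_real of_real_mult complex_norm_square)
  show "integrable lborel (\<lambda>z. f z * (cmod (mv_power z \<alpha>))\<^sup>2)"
    using integrable_Re[OF moment_integrable[of \<alpha> \<alpha>]] unfolding eq by simp
  have "complex_of_real (LINT z|lborel. f z * (cmod (mv_power z \<alpha>))\<^sup>2) = of_nat (mv_fact \<alpha>)"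
    using moment[of \<alpha> \<alpha>] unfolding eq integral_complex_of_real by simp
  then show "(LINT z|lborel. f z * (cmod (mv_power z \<alpha>))\<^sup>2) = real (mv_fact \<alpha>)"
    by (metis of_real_eq_iff of_real_of_nat_eq)
qed

text \<open>
  This is the growth condition that makes the moment problem determinate. The moments
  \<open>\<integral> f |z\<^sup>\<alpha>|\<^sup>2 = \<alpha>!\<close> turn the expansion of \<open>exp (|z|\<^sup>2 / 2)\<close> into a product of
  geometric series of ratio \<open>1 / 2\<close>.
\<close>
lemma exp_square_integrable: "integrable lborel (\<lambda>z. f z * exp ((norm z)\<^sup>2 / 2))"
proof -
  define u where "u N z = (\<Prod>i\<in>UNIV. \<Sum>k<N. ((cmod (z $ i))\<^sup>2 / 2) ^ k / fact k)" for N and z :: "complex ^ 'n"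
  define w where "w \<alpha> = (\<Prod>i\<in>UNIV. (1 / 2 :: real) ^ (\<alpha> $ i))" for \<alpha> :: "nat ^ 'n"
  let ?A = "\<lambda>N. {\<alpha>::nat^'n. \<forall>i. \<alpha> $ i < N}"
  have u_eq: "u N z = (\<Sum>\<alpha>\<in>?A N. w \<alpha> / mv_fact \<alpha> * (cmod (mv_power z \<alpha>))\<^sup>2)" for N z
  proof -
    have "(x\<^sup>2 / 2) ^ k / fact k = (1 / 2) ^ k / fact k * (x ^ k)\<^sup>2" for x :: real and k
      by (simp add: power_divide power_mult[symmetric] mult.commute)
    then have "(\<Prod>i\<in>UNIV. ((cmod (z $ i))\<^sup>2 / 2) ^ (\<alpha> $ i) / fact (\<alpha> $ i)) = 
        w \<alpha> / mv_fact \<alpha> * (cmod (mv_power z \<alpha>))\<^sup>2" for \<alpha>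
      by (simp add: w_def mv_fact_def mv_power_def prod_norm[symmetric] norm_power prod_dividef prod.distrib
          prod_power_distrib)
    then show ?thesis
      unfolding u_def prod_sum_multi_index by simp
  qed
  have fu: "f z * u N z = (\<Sum>\<alpha>\<in>?A N. w \<alpha> / mv_fact \<alpha> * (f z * (cmod (mv_power z \<alpha>))\<^sup>2))" for N z
    by (simp add: u_eq sum_distrib_left mult_ac)
  have int: "integrable lborel (\<lambda>z. f z * u N z)" for N
    unfolding fu by (intro Bochner_Integration.integrable_sum integrable_mult_right abs_moment)
  have "(LINT z|lborel. f z * u N z) = (\<Sum>\<alpha>\<in>?A N. w \<alpha>)" for N
    unfolding fu using abs_moment
    by (subst Bochner_Integration.integral_sum) auto
  then have val: "(LINT z|lborel. f z * u N z) = (\<Prod>i\<in>(UNIV::'n set). \<Sum>k<N. (1 / 2) ^ k)" for N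
    unfolding w_def prod_sum_multi_index .
  show ?thesis
  proof (rule integrable_monotone_convergence[OF int])
    show "AE z in lborel. mono (\<lambda>N. f z * u N z)"
      unfolding u_def
      by (intro AE_I2 monoI mult_left_mono nonneg prod_mono conjI sum_nonneg sum_mono2) auto
    show "AE z in lborel. (\<lambda>N. f z * u N z) \<longlonglongrightarrow> f z * exp ((norm z)\<^sup>2 / 2)"
    proof (rule AE_I2)
      fix z :: "complex ^ 'n"
      have "exp ((norm z)\<^sup>2 / 2) = (\<Prod>i\<in>UNIV. exp ((cmod (z $ i))\<^sup>2 / 2))"
        by (simp add: norm_vec_complex_sq exp_sum sum_divide_distrib)
      then show "(\<lambda>N. f z * u N z) \<longlonglongrightarrow> f z * exp ((norm z)\<^sup>2 / 2)"
        unfolding u_def by (auto intro!: tendsto_intros partial_exp_tendsto)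
    qed
    \<comment> \<open>Hence the integrals converge, with limit \<open>2 ^ n\<close>.\<close>
    have "(\<lambda>k. (1 / 2 :: real) ^ k) sums (1 / (1 - 1 / 2))"
      by (rule geometric_sums) simp
    then show "(\<lambda>N. LINT z|lborel. f z * u N z) \<longlonglongrightarrow> (\<Prod>i\<in>(UNIV::'n set). 1 / (1 - 1 / 2))"
      unfolding val sums_def by (rule tendsto_prod)
  qed measurable
qed

text \<open>
  The partial products of the exponential series are polynomials, whose inner products are given
  by the moments and add up to a partial product of the series of the right-hand side. The limit
  is taken under the integral, dominated by a multiple of \<open>f z * exp (|z|\<^sup>2 / 2)\<close>.
\<close>
lemma integral_exp_linear:
  fixes c d :: "complex ^ 'n"
  shows "(LINT z|lborel. f z *\<^sub>R (exp (\<Sum>i\<in>UNIV. c $ i * z $ i) * cnj (exp (\<Sum>i\<in>UNIV. d $ i * z $ i)))) =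
           exp (\<Sum>i\<in>UNIV. c $ i * cnj (d $ i))"
proof -
  let ?A = "\<lambda>N. {\<alpha>::nat^'n. \<forall>i. \<alpha> $ i < N}"
  define P where "P x N z = (\<Prod>i\<in>UNIV. \<Sum>k<N. (x $ i * z $ i) ^ k / fact k)" 
    for N and x z :: "complex ^ 'n"
  have P_eq: "P x N z = (\<Sum>\<alpha>\<in>?A N. mv_power x \<alpha> / mv_fact \<alpha> * mv_power z \<alpha>)" for x z N
    unfolding P_def prod_sum_multi_index
    by (simp add: mv_fact_def mv_power_def prod_dividef prod.distrib power_mult_distrib)
  have P_lim: "(\<lambda>N. P x N z) \<longlonglongrightarrow> exp (\<Sum>i\<in>UNIV. x $ i * z $ i)" for x z
    unfolding P_def by (simp add: exp_sum) (intro tendsto_prod partial_exp_tendsto)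
  have P_bound: "norm (P x N z) \<le> exp (\<Sum>i\<in>UNIV. cmod (x $ i) * cmod (z $ i))" for x z N
    unfolding P_def exp_sum[OF finite] norm_mult[symmetric] prod_norm[symmetric]
    by (intro prod_mono conjI norm_ge_zero norm_partial_exp_le)
  have PP: "f z *\<^sub>R (P c N z * cnj (P d N z)) = 
     (\<Sum>\<alpha>\<in>?A N. \<Sum>\<beta>\<in>?A N. (mv_power c \<alpha> / mv_fact \<alpha> * cnj (mv_power d \<beta> / mv_fact \<beta>)) *
        (f z *\<^sub>R (mv_power z \<alpha> * cnj (mv_power z \<beta>))))" for N z
    unfolding P_eq cnj_sum sum_product scaleR_sum_right by (simp add: scaleR_conv_of_real mult_ac)
  have "(LINT z|lborel. f z *\<^sub>R (P c N z * cnj (P d N z))) = 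
     (\<Sum>\<alpha>\<in>?A N. \<Sum>\<beta>\<in>?A N. (mv_power c \<alpha> / mv_fact \<alpha> * cnj (mv_power d \<beta> / mv_fact \<beta>)) *
        (if \<alpha> = \<beta> then of_nat (mv_fact \<alpha>) else 0))" for N
    unfolding PP moment[symmetric]
    by (simp only: Bochner_Integration.integral_sum Bochner_Integration.integrable_sum
        integral_mult_right_zero integrable_mult_right moment_integrable)
  also have "\<dots> N = (\<Sum>\<alpha>\<in>?A N. mv_power c \<alpha> / mv_fact \<alpha> * cnj (mv_power d \<alpha> / mv_fact \<alpha>) * of_nat (mv_fact \<alpha>))" for N
    by (intro sum.cong refl) (simp add: finite_multi_index_box if_distrib sum.delta cong: if_cong)
  also have "\<dots> N = P c N (\<chi> i. cnj (d $ i))" for N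
    unfolding P_eq
    by (intro sum.cong refl) (auto simp: mv_power_def)
  finally have val: "(LINT z|lborel. f z *\<^sub>R (P c N z * cnj (P d N z))) = P c N (\<chi> i. cnj (d $ i))" for N .
  define K where "K = exp (\<Sum>i\<in>UNIV. (cmod (c $ i) + cmod (d $ i))\<^sup>2 / 2)"
  have bound: "norm (f z *\<^sub>R (P c N z * cnj (P d N z))) \<le> K * (f z * exp ((norm z)\<^sup>2 / 2))" for z N
  proof -
    have "norm (P c N z) * norm (P d N z) \<le>
       exp (\<Sum>i\<in>UNIV. cmod (c $ i) * cmod (z $ i)) * exp (\<Sum>i\<in>UNIV. cmod (d $ i) * cmod (z $ i))"
      by (intro mult_mono P_bound) auto
    also have "\<dots> = exp (\<Sum>i\<in>UNIV. (cmod (c $ i) + cmod (d $ i)) * cmod (z $ i))"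
      by (simp add: exp_add[symmetric] sum.distrib[symmetric] distrib_right)
    also have "\<dots> \<le> exp (\<Sum>i\<in>UNIV. (cmod (c $ i) + cmod (d $ i))\<^sup>2 / 2 + (cmod (z $ i))\<^sup>2 / 2)"
    proof -
      have "a * b \<le> a\<^sup>2 / 2 + b\<^sup>2 / 2" for a b :: real
        using sum_squares_bound[of a b] by simp
      then show ?thesis by (simp only: exp_le_cancel_iff) (intro sum_mono)
    qed
    also have "\<dots> = K * exp ((norm z)\<^sup>2 / 2)"
      by (simp add: K_def sum.distrib exp_add norm_vec_complex_sq sum_divide_distrib)
    finally show ?thesis
      using nonneg[of z] by (simp add: norm_mult mult_left_mono mult.left_commute[of K])
  qed
  have [measurable]: "P x N \<in> borel_measurable borel" for x N
    unfolding P_def by (intro borel_measurable_continuous_onI continuous_intros) auto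
  have "(\<lambda>N. LINT z|lborel. f z *\<^sub>R (P c N z * cnj (P d N z))) \<longlonglongrightarrow> 
     (LINT z|lborel. f z *\<^sub>R (exp (\<Sum>i\<in>UNIV. c $ i * z $ i) * cnj (exp (\<Sum>i\<in>UNIV. d $ i * z $ i))))"
  proof (rule integral_dominated_convergence)
    show "integrable lborel (\<lambda>z. K * (f z * exp ((norm z)\<^sup>2 / 2)))"
      by (intro integrable_mult_right exp_square_integrable)
    show "AE z in lborel. norm (f z *\<^sub>R (P c N z * cnj (P d N z))) \<le> K * (f z * exp ((norm z)\<^sup>2 / 2))" for N
      using bound by simp
    show "AE z in lborel. (\<lambda>N. f z *\<^sub>R (P c N z * cnj (P d N z))) \<longlonglongrightarrow>
       f z *\<^sub>R (exp (\<Sum>i\<in>UNIV. c $ i * z $ i) * cnj (exp (\<Sum>i\<in>UNIV. d $ i * z $ i)))"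
      by (intro AE_I2 tendsto_intros tendsto_cnj P_lim)
    have "(\<lambda>z. exp (\<Sum>i\<in>UNIV. x $ i * z $ i)) \<in> borel_measurable borel" for x :: "complex ^ 'n"
      by (intro borel_measurable_continuous_onI continuous_intros)
    note this[measurable]
    show "(\<lambda>z. f z *\<^sub>R (exp (\<Sum>i\<in>UNIV. c $ i * z $ i) * cnj (exp (\<Sum>i\<in>UNIV. d $ i * z $ i)))) \<in> borel_measurable lborel"
      by measurable
  qed measurable
  moreover have "(\<lambda>N. LINT z|lborel. f z *\<^sub>R (P c N z * cnj (P d N z))) \<longlonglongrightarrow> exp (\<Sum>i\<in>UNIV. c $ i * cnj (d $ i))"
    unfolding val using P_lim[of c "\<chi> i. cnj (d $ i)"] by simp
  ultimately show ?thesis by (rule LIMSEQ_unique)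
qed

text \<open>
  A real character is the product of a holomorphic and an antiholomorphic exponential:
  \<open>\<i> (\<xi> \<bullet> z) = (\<i> / 2) (\<Sum>i. cnj \<xi>\<^sub>i * z\<^sub>i + \<xi>\<^sub>i * cnj z\<^sub>i)\<close>.
\<close>
lemma fourier_transform:
  "(LINT z|lborel. iexp (\<xi> \<bullet> z) * complex_of_real (f z)) = complex_of_real (exp (- ((norm \<xi>)\<^sup>2 / 4)))"
proof -
  define c where "c = (\<chi> i. \<i> / 2 * cnj (\<xi> $ i))"
  define d where "d = (\<chi> i. - \<i> / 2 * cnj (\<xi> $ i))"
  have "iexp (\<xi> \<bullet> z) = exp (\<Sum>i\<in>UNIV. c $ i * z $ i) * cnj (exp (\<Sum>i\<in>UNIV. d $ i * z $ i))" for z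
  proof -
    have "\<i> * complex_of_real (x \<bullet> y) = \<i> / 2 * cnj x * y + cnj (- \<i> / 2 * cnj x * y)" for x y
      by (simp add: complex_eq_iff inner_complex_def field_simps)
    then have "\<i> * complex_of_real (\<xi> \<bullet> z) = (\<Sum>i\<in>UNIV. c $ i * z $ i + cnj (d $ i * z $ i))"
      by (simp add: inner_vec_def c_def d_def sum_distrib_left)
    then show ?thesis
      by (simp add: exp_add[symmetric] exp_cnj sum.distrib)
  qed
  then have "(LINT z|lborel. iexp (\<xi> \<bullet> z) * complex_of_real (f z)) = exp (\<Sum>i\<in>UNIV. c $ i * cnj (d $ i))"
    using integral_exp_linear[of c d] by (simp add: scaleR_conv_of_real mult_ac)
  also have "c $ i * cnj (d $ i) = complex_of_real (- (cmod (\<xi> $ i))\<^sup>2 / 4)" for i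
    by (simp only: of_real_divide of_real_minus complex_norm_square) (simp add: c_def d_def mult_ac)
  then have "(\<Sum>i\<in>UNIV. c $ i * cnj (d $ i)) = complex_of_real (- ((norm \<xi>)\<^sup>2 / 4))"
    by (simp add: norm_vec_complex_sq sum_divide_distrib sum_negf)
  finally show ?thesis by (simp only: exp_of_real)
qed

lemma f_integrable: "integrable lborel f"
  using abs_moment(1)[of 0] by (simp add: mv_power_def)

text \<open>
  \<open>DIM(complex ^ 'n)\<close> is the real dimension \<open>2 n\<close>, so the constant is \<open>\<pi> ^ n\<close>.
\<close>
lemma eq_gaussian_at_continuity_point:
  assumes "isCont f x"
  shows "f x = exp (- (norm x)\<^sup>2) / sqrt pi ^ DIM(complex ^ 'n)"
proof -
  define C where "C = sqrt pi ^ DIM(complex ^ 'n)"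
  have C: "C > 0" by (simp add: C_def)
  define g where "g x = exp (- (norm x)\<^sup>2) / C" for x :: "complex ^ 'n"
  have g_ft: "integrable lborel (\<lambda>z. iexp (\<xi> \<bullet> z) * complex_of_real (g z))"
    "(LINT z|lborel. iexp (\<xi> \<bullet> z) * complex_of_real (g z)) = complex_of_real (exp (- ((norm \<xi>)\<^sup>2 / 4)))" for \<xi>
    using gaussian_fourier[of 2 \<xi>] C by (simp_all add: g_def C_def exp_of_real del: DIM_cart)
  have g: "integrable lborel g"
    using integrable_Re[OF g_ft(1)[of 0]] by simp
  have "f x - g x = 0"
  proof (rule fourier_zero_imp_zero_at_continuity_point[where h = "\<lambda>x. f x - g x"])
    show "integrable lborel (\<lambda>x. f x - g x)"
      using f_integrable g by simp
    show "isCont (\<lambda>x. f x - g x) x"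
      unfolding g_def using assms C by (intro continuous_intros) auto
    show "(LINT z|lborel. iexp (\<xi> \<bullet> z) * complex_of_real (f z - g z)) = 0" for \<xi>
    proof -
      have "integrable lborel (\<lambda>z. iexp (\<xi> \<bullet> z) * complex_of_real (f z))"
        using f_integrable by (rule Bochner_Integration.integrable_bound) (auto simp: norm_mult)
      then show ?thesis
        using g_ft fourier_transform[of \<xi>] by (simp add: right_diff_distrib)
    qed
  qed
  then show ?thesis by (simp add: g_def C_def)
qed

end

section \<open>The modulus of a holomorphic function of several variables\<close>

lemma mv_holomorphic_continuous_on: "f mv_holomorphic_on D \<Longrightarrow> continuous_on D f"
  unfolding mv_holomorphic_on_def continuous_on_eq_continuous_within
  by (meson has_derivative_continuous)

lemma axis_complex: "axis i (t::complex) = t *s axis i 1"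
  by (simp add: vec_eq_iff axis_def)

lemma norm_axis_complex: "norm (axis i (t::complex) :: complex ^ 'n) = cmod t"
  by (simp add: norm_eq_sqrt_inner inner_axis)

lemma mv_holomorphic_slice:
  fixes f :: "complex ^ 'n \<Rightarrow> complex"
  assumes hol: "f mv_holomorphic_on D" and D: "open D" and S: "open S" and sub: "\<And>t. t \<in> S \<Longrightarrow> z + axis i t \<in> D"
  shows "(\<lambda>t. f (z + axis i t)) holomorphic_on S"
  unfolding holomorphic_on_open[OF S]
proof
  fix t assume t: "t \<in> S"
  obtain L where L: "Vector_Spaces.linear (*s) (*) L" "(f has_derivative L) (at (z + axis i t))"
    using hol sub[OF t] D unfolding mv_holomorphic_on_def by (metis at_within_open)
  have "linear (\<lambda>t::complex. axis i t :: complex ^ 'n)"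
    by (rule linearI) (auto simp: axis_def vec_eq_iff)
  then have "((\<lambda>t. z + axis i t) has_derivative (\<lambda>t. axis i t)) (at t)"
    by (auto intro!: derivative_eq_intros linear_imp_has_derivative)
  from has_derivative_compose[OF this L(2)]
  have "((\<lambda>t. f (z + axis i t)) has_derivative (\<lambda>s. L (axis i s))) (at t)" .
  moreover interpret L: Vector_Spaces.linear "(*s)" "(*)" L by (rule L(1))
  have "(\<lambda>s. L (axis i s)) = (*) (L (axis i 1))"
    by (rule ext, subst axis_complex) (simp add: L.scale mult.commute)
  ultimately show "\<exists>f'. ((\<lambda>t. f (z + axis i t)) has_field_derivative f') (at t)"
    unfolding has_field_derivative_def by metis
qed

text \<open>
  On a complex line through \<open>z\<close> in a coordinate direction, multiplying \<open>\<phi>\<close> by the holomorphic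
  function \<open>exp (cnj z\<^sub>i t)\<close> cancels the term of \<open>|z + t e\<^sub>i|\<^sup>2\<close> that is linear in \<open>t\<close>. The modulus of
  the product is then a multiple of \<open>exp (- |t|\<^sup>2 / 2)\<close>, with a strict maximum at \<open>t = 0\<close>, which
  the maximum modulus principle forbids.
\<close>
lemma holomorphic_modulus_not_gaussian:
  fixes \<phi> :: "complex ^ 'n \<Rightarrow> complex"
  assumes hol: "\<phi> mv_holomorphic_on D" and D: "open D" "z \<in> D" and C: "C > 0"
    and eq: "\<And>w. w \<in> D \<Longrightarrow> (cmod (\<phi> w))\<^sup>2 = C * exp (- (norm w)\<^sup>2)"
  shows False
proof -
  obtain r where r: "r > 0" "ball z r \<subseteq> D"
    using D open_contains_ball by blast
  \<comment> \<open>Any coordinate direction will do; there is one because types are nonempty.\<close>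
  fix i :: 'n
  have in_D: "z + axis i t \<in> D" if "t \<in> ball 0 r" for t
    using that r by (intro subsetD[OF r(2)]) (auto simp: dist_norm norm_axis_complex)
  define G where "G t = \<phi> (z + axis i t) * exp (cnj (z $ i) * t)" for t
  have G_hol: "G holomorphic_on ball 0 r"
    unfolding G_def by (intro holomorphic_intros mv_holomorphic_slice[OF hol D(1)] in_D) auto
  define B where "B = C * exp (- (norm z)\<^sup>2)"
  have B: "B > 0" using C by (simp add: B_def)
  have G_norm: "(cmod (G t))\<^sup>2 = B * exp (- (cmod t)\<^sup>2)" if "t \<in> ball 0 r" for t
  proof -
    define b where "b = 2 * Re (cnj (z $ i) * t)"
    have "(norm (z + axis i t))\<^sup>2 = (norm z)\<^sup>2 + b + (cmod t)\<^sup>2"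
      unfolding b_def power2_norm_eq_inner
      by (simp add: inner_add_left inner_add_right inner_axis inner_axis' inner_complex_def
          cmod_power2 power2_eq_square algebra_simps)
    moreover have "(cmod (exp (cnj (z $ i) * t)))\<^sup>2 = exp b"
      by (simp only: b_def norm_exp_eq_Re exp_double)
    ultimately have "(cmod (G t))\<^sup>2 = C * exp (- ((norm z)\<^sup>2 + b + (cmod t)\<^sup>2)) * exp b"
      using eq[OF in_D[OF that]] by (simp only: G_def norm_mult power_mult_distrib)
    also have "\<dots> = B * exp (- (cmod t)\<^sup>2)"
      by (simp add: B_def mult_exp_exp mult.assoc)
    finally show ?thesis .
  qed
  have "G constant_on ball 0 r"
  proof (rule maximum_modulus_principle[OF G_hol])
    fix t assume t: "t \<in> ball (0::complex) r"
    have "(cmod (G t))\<^sup>2 \<le> (cmod (G 0))\<^sup>2"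
      using G_norm[OF t] G_norm[of 0] r B by simp
    then show "cmod (G t) \<le> cmod (G 0)" by (rule power2_le_imp_le) simp
  qed (use r in auto)
  moreover have h: "complex_of_real (r / 2) \<in> ball 0 r" "0 \<in> ball (0::complex) r" using r by auto
  ultimately have "G (complex_of_real (r / 2)) = G 0"
    unfolding constant_on_def by metis
  then have "B * exp (- (r / 2)\<^sup>2) = B"
    using G_norm[OF h(1)] G_norm[OF h(2)] r by simp
  then show False using B r by simp
qed

section \<open>Bergman spaces\<close>

theorem theorem1p6:
  "\<not> (\<exists>(D :: (complex ^ 'n) set) \<phi>.
        cdomain D \<and> \<phi> \<in> bergman_space D \<and> (\<exists>z\<in>D. \<phi> z \<noteq> 0) \<and> L2_norm D \<phi> = 1 \<and>
        bergman_orthonormal_basis D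
          (\<lambda>(\<alpha> :: nat ^ 'n) z. mv_power z \<alpha> / complex_of_real (sqrt (real (mv_fact \<alpha>))) * \<phi> z))"
proof (safe)
  fix D :: "(complex ^ 'n) set" and \<phi> z
  define e where "e = (\<lambda>(\<alpha> :: nat ^ 'n) z. mv_power z \<alpha> / complex_of_real (sqrt (real (mv_fact \<alpha>))) * \<phi> z)"
  assume dom: "cdomain D" and \<phi>: "\<phi> \<in> bergman_space D" and z: "z \<in> D"
    and "bergman_orthonormal_basis D
          (\<lambda>(\<alpha> :: nat ^ 'n) z. mv_power z \<alpha> / complex_of_real (sqrt (real (mv_fact \<alpha>))) * \<phi> z)"
  then have e: "e \<alpha> \<in> bergman_space D" "L2_inner D (e \<alpha>) (e \<beta>) = (if \<alpha> = \<beta> then 1 else 0)" for \<alpha> \<beta>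
    by (auto simp: bergman_orthonormal_basis_def e_def)
  have D: "open D" using dom by (simp add: cdomain_def)
  have hol: "\<phi> mv_holomorphic_on D" using \<phi> by (simp add: bergman_space_def)
  have cont: "continuous_on D \<phi>" by (rule mv_holomorphic_continuous_on[OF hol])
  define f where "f w = indicator D w * (cmod (\<phi> w))\<^sup>2" for w
  have f_meas [measurable]: "f \<in> borel_measurable borel"
    unfolding f_def using borel_measurable_continuous_on_indicator[of D "\<lambda>w. (cmod (\<phi> w))\<^sup>2"]
    by (simp add: D cont continuous_on_power continuous_on_norm)
  have fact_neq: "real (mv_fact \<alpha>) \<noteq> 0" for \<alpha> :: "nat ^ 'n"
    by simp
  have diag: "integrable lborel (\<lambda>w. f w * (cmod (mv_power w \<alpha>))\<^sup>2)" for \<alpha>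
  proof -
    have "indicator D w *\<^sub>R (cmod (e \<alpha> w))\<^sup>2 = (1 / real (mv_fact \<alpha>)) * (f w * (cmod (mv_power w \<alpha>))\<^sup>2)" for w
      by (simp add: e_def f_def norm_mult norm_divide power_mult_distrib power_divide)
    then have "integrable lebesgue (\<lambda>w. (1 / real (mv_fact \<alpha>)) * (f w * (cmod (mv_power w \<alpha>))\<^sup>2))"
      using e(1)[of \<alpha>] by (simp add: bergman_space_def set_integrable_def)
    from integrable_mult_right[OF this, of "real (mv_fact \<alpha>)"]
    have "integrable lebesgue (\<lambda>w. f w * (cmod (mv_power w \<alpha>))\<^sup>2)"
      using fact_neq[of \<alpha>] by simp
    \<comment> \<open>The integrand is Borel measurable, so completing the measure changes nothing.\<close>
    then show ?thesis by (subst (asm) integrable_completion) auto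
  qed
  \<comment> \<open>Orthonormality of the family, cleared of the normalising factors.\<close>
  have "gaussian_moments f"
  proof
    show "0 \<le> f w" for w by (simp add: f_def)
    show "f \<in> borel_measurable borel" by (rule f_meas)
    fix \<alpha> \<beta> :: "nat ^ 'n"
    let ?m = "\<lambda>w. f w *\<^sub>R (mv_power w \<alpha> * cnj (mv_power w \<beta>))"
    have "integrable lborel (\<lambda>w. f w * (cmod (mv_power w \<alpha>))\<^sup>2 + f w * (cmod (mv_power w \<beta>))\<^sup>2)"
      by (intro Bochner_Integration.integrable_add diag)
    then show "integrable lborel ?m"
    proof (rule Bochner_Integration.integrable_bound)
      have "a * b \<le> a\<^sup>2 + b\<^sup>2" if "a \<ge> 0" "b \<ge> 0" for a b :: real
        using sum_squares_bound[of a b] that mult_nonneg_nonneg[of a b] by linarith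
      then have "f w * (cmod (mv_power w \<alpha>) * cmod (mv_power w \<beta>))
          \<le> f w * ((cmod (mv_power w \<alpha>))\<^sup>2 + (cmod (mv_power w \<beta>))\<^sup>2)" for w
        by (intro mult_left_mono) (auto simp: f_def)
      moreover have "f w \<ge> 0" for w by (simp add: f_def)
      ultimately show "AE w in lborel. norm (?m w) \<le>
          norm (f w * (cmod (mv_power w \<alpha>))\<^sup>2 + f w * (cmod (mv_power w \<beta>))\<^sup>2)"
        by (auto simp: norm_mult distrib_left)
    qed measurable
    define k where "k = sqrt (real (mv_fact \<alpha>)) * sqrt (real (mv_fact \<beta>))"
    have k: "k > 0" by (simp add: k_def zero_less_mult_iff neq0_conv[symmetric] del: neq0_conv)
    have "k *\<^sub>R (indicator D w *\<^sub>R (e \<alpha> w * cnj (e \<beta> w))) = ?m w" for w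
      using fact_neq[of \<alpha>] fact_neq[of \<beta>]
      by (cases "w \<in> D")
        (simp_all add: e_def f_def k_def scaleR_conv_of_real complex_norm_square mult_ac del: of_real_power)
    then have "k *\<^sub>R (LINT w|lebesgue. indicator D w *\<^sub>R (e \<alpha> w * cnj (e \<beta> w))) = integral\<^sup>L lebesgue ?m"
      by (simp only: integral_scaleR_right[symmetric])
    also have "integral\<^sup>L lebesgue ?m = integral\<^sup>L lborel ?m"
      by (rule integral_completion) measurable
    finally have "integral\<^sup>L lborel ?m = k *\<^sub>R (LINT w|lebesgue. indicator D w *\<^sub>R (e \<alpha> w * cnj (e \<beta> w)))"
      by simp
    also have "\<dots> = k *\<^sub>R (if \<alpha> = \<beta> then 1 else 0)"
      using e(2)[of \<alpha> \<beta>] by (simp add: L2_inner_def set_lebesgue_integral_def)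
    finally show "integral\<^sup>L lborel ?m = (if \<alpha> = \<beta> then of_nat (mv_fact \<alpha>) else 0)"
      by (auto simp: k_def scaleR_conv_of_real simp flip: of_real_mult)
  qed
  then interpret gaussian_moments f .
  have "(cmod (\<phi> w))\<^sup>2 = (1 / sqrt pi ^ DIM(complex ^ 'n)) * exp (- (norm w)\<^sup>2)" if w: "w \<in> D" for w
  proof -
    have "isCont (\<lambda>w. (cmod (\<phi> w))\<^sup>2) w"
      using cont w D by (intro continuous_intros) (simp add: continuous_on_eq_continuous_at)
    moreover have "eventually (\<lambda>v. f v = (cmod (\<phi> v))\<^sup>2) (nhds w)"
      using D w by (auto simp: eventually_nhds f_def indicator_def)
    ultimately have "isCont f w" by (simp add: isCont_cong)
    from eq_gaussian_at_continuity_point[OF this] show ?thesis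
      using w by (simp add: f_def)
  qed
  moreover have "0 < 1 / sqrt pi ^ DIM(complex ^ 'n)"
    by (intro divide_pos_pos zero_less_power) auto
  ultimately show False
    using holomorphic_modulus_not_gaussian[OF hol D z] by blast
qed

end
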